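(* $\{(r_0,r_1)\in\mathbb{R}^2 \mid r_0-r_1<-1,\ r_0\ge 0\}\subset\mathcal{D}_2^{( * )}$.
   Context: For $\mathbf{r}=(r_0,r_1)\in\mathbb{R}^2$, the two-dimensional shift radix system is the map $\tau_{\mathbf{r}}:\mathbb{Z}^2\to\mathbb{Z}^2$, $\tau_{\mathbf{r}}(a_0,a_1)=(a_1,-\lfloor r_0a_0+r_1a_1\rfloor)$. The orbit of $(a_0,a_1)$ is identified with the integer sequence $(a_n)_{n\ge 0}$ where $a_{n+2}=-\lfloor r_0a_n+r_1a_{n+1}\rfloor$ for $n\ge0$. An orbit is ultimately periodic if there are $n_0\ge 0$, $p>0$ with $a_{n+p}=a_n$ for all $n\ge n_0$; it ends up in the trivial cycle if $a_n=0$ for all sufficiently large $n$. $\mathcal{D}_2^{( * )}$ is the set of all $\mathbf{r}\in\mathbb{R}^2$ such that each ultimately periodic orbit of $\tau_{\mathbf{r}}$ ends up in the trivial cycle. *)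

theory Defs
  imports Complex_Main
begin

definition srs :: "real \<times> real \<Rightarrow> int \<times> int \<Rightarrow> int \<times> int" where
  "srs r a = (snd a, - \<lfloor>fst r * real_of_int (fst a) + snd r * real_of_int (snd a)\<rfloor>)"

text \<open>The orbit of a point is identified with the integer sequence of the first components
  of its iterates; the two lemmas below justify this.\<close>

definition srs_orbit :: "real \<times> real \<Rightarrow> int \<times> int \<Rightarrow> nat \<Rightarrow> int" where
  "srs_orbit r a n = fst ((srs r ^^ n) a)"

lemma srs_iterate: "(srs r ^^ n) a = (srs_orbit r a n, srs_orbit r a (Suc n))"
  by (simp add: srs_orbit_def srs_def prod_eq_iff)

lemma srs_orbit_recurrence:
  "srs_orbit r a 0 = fst a"
  "srs_orbit r a (Suc 0) = snd a"
  "srs_orbit r a (n + 2) =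
     - \<lfloor>fst r * real_of_int (srs_orbit r a n) + snd r * real_of_int (srs_orbit r a (n + 1))\<rfloor>"
  by (simp_all add: srs_orbit_def srs_def)

definition ultimately_periodic :: "(nat \<Rightarrow> int) \<Rightarrow> bool" where
  "ultimately_periodic s \<longleftrightarrow> (\<exists>n0 p. p > 0 \<and> (\<forall>n\<ge>n0. s (n + p) = s n))"

definition ends_in_trivial_cycle :: "(nat \<Rightarrow> int) \<Rightarrow> bool" where
  "ends_in_trivial_cycle s \<longleftrightarrow> (\<exists>n0. \<forall>n\<ge>n0. s n = 0)"

definition D2_star :: "(real \<times> real) set" where
  "D2_star = {r. \<forall>a. ultimately_periodic (srs_orbit r a) \<longrightarrow> ends_in_trivial_cycle (srs_orbit r a)}"

end

theory Submission
  imports Defs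
begin

text \<open>Suppose that the periodic part of an orbit has maximal modulus \<open>M > 0\<close>. Because
  \<open>r1 - r0 > 1\<close>, a term \<open>M\<close> is followed by a term \<open>\<le> -M\<close>, hence by \<open>-M\<close>, and a term \<open>-M\<close> is
  followed by a term \<open>> M\<close>: the asymmetry of the floor function makes the latter inequality
  strict, which contradicts the choice of \<open>M\<close>.\<close>

text \<open>Since \<open>a \<ge> - b\<close>, the combination is at least
  \<open>(r1 - r0) * b \<ge> b\<close>, and the floor respects an integer lower bound.\<close>

lemma floor_combination_pos:
  fixes r0 r1 :: real and a b :: int
  assumes "r0 \<ge> 0" "r0 - r1 < -1" "\<bar>a\<bar> \<le> b" "b > 0"
  shows "- \<lfloor>r0 * of_int a + r1 * of_int b\<rfloor> \<le> - b"
proof -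
  have "r0 * of_int (- b) \<le> r0 * of_int a"
    using assms by (intro mult_left_mono) linarith+
  moreover have "1 * of_int b \<le> (r1 - r0) * of_int b"
    using assms by (intro mult_right_mono) auto
  ultimately have "of_int b \<le> r0 * of_int a + r1 * of_int b"
    by (simp add: algebra_simps)
  then show ?thesis by (simp add: le_floor_iff)
qed

text \<open>Since \<open>a \<le> - b\<close>, the combination is at most
  \<open>(r1 - r0) * b < b\<close>; rounding down keeps this strict.\<close>

lemma floor_combination_neg:
  fixes r0 r1 :: real and a b :: int
  assumes "r0 \<ge> 0" "r0 - r1 < -1" "\<bar>a\<bar> \<le> - b" "b < 0"
  shows "- b < - \<lfloor>r0 * of_int a + r1 * of_int b\<rfloor>"
proof -
  have "r0 * of_int a \<le> r0 * of_int (- b)"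
    using assms by (intro mult_left_mono) linarith+
  moreover have "(r1 - r0) * of_int b < 1 * of_int b"
    using assms by (intro mult_strict_right_mono_neg) auto
  ultimately have "r0 * of_int a + r1 * of_int b < of_int b"
    by (simp add: algebra_simps)
  then show ?thesis by (simp add: floor_less_iff)
qed

text \<open>One period contains all values. The maximum is placed at a successor index so that the
  term before it also obeys the bound.\<close>

lemma periodic_abs_max:
  fixes s :: "nat \<Rightarrow> int"
  assumes "p > 0" and per: "\<And>n. n \<ge> n0 \<Longrightarrow> s (n + p) = s n"
  obtains k where "k \<ge> n0" "\<And>n. n \<ge> n0 \<Longrightarrow> \<bar>s n\<bar> \<le> \<bar>s (Suc k)\<bar>"
proof -
  let ?A = "(\<lambda>n. \<bar>s n\<bar>) ` {n0..<n0 + p}"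
  have in_A: "\<bar>s n\<bar> \<in> ?A" if "n \<ge> n0" for n
    using that
  proof (induction n rule: less_induct)
    case (less n)
    show ?case
    proof (cases "n < n0 + p")
      case False
      then show ?thesis
        using less.IH[of "n - p"] per[of "n - p"] \<open>p > 0\<close> by simp
    qed (use less.prems in auto)
  qed
  have "Max ?A \<in> ?A" using \<open>p > 0\<close> by (intro Max_in) auto
  then obtain m where m: "m \<ge> n0" "Max ?A = \<bar>s m\<bar>" by auto
  show thesis
  proof
    \<comment> \<open>Moving \<open>m\<close> one period on leaves room for a predecessor even if
      \<open>m = n0\<close>.\<close>
    show "m + p - 1 \<ge> n0" using m \<open>p > 0\<close> by simp
    show "\<bar>s n\<bar> \<le> \<bar>s (Suc (m + p - 1))\<bar>" if "n \<ge> n0" for n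
      using Max_ge[OF _ in_A[OF that]] m per \<open>p > 0\<close> by simp
  qed
qed

theorem theorem4:
  "{(r0, r1) :: real \<times> real | r0 r1. r0 - r1 < -1 \<and> r0 \<ge> 0} \<subseteq> D2_star"
proof -
  have "ends_in_trivial_cycle (srs_orbit (r0, r1) a)"
    if r: "r0 \<ge> 0" "r0 - r1 < -1" and periodic: "ultimately_periodic (srs_orbit (r0, r1) a)"
    for r0 r1 :: real and a
  proof -
    let ?s = "srs_orbit (r0, r1) a"
    obtain n0 p where p: "p > 0" "\<And>n. n \<ge> n0 \<Longrightarrow> ?s (n + p) = ?s n"
      using periodic unfolding ultimately_periodic_def by auto
    obtain k where k: "k \<ge> n0" and max: "\<And>n. n \<ge> n0 \<Longrightarrow> \<bar>?s n\<bar> \<le> \<bar>?s (Suc k)\<bar>"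
      using periodic_abs_max[where s = ?s, OF p] by metis
    have step: "?s (Suc (Suc n)) = - \<lfloor>r0 * of_int (?s n) + r1 * of_int (?s (Suc n))\<rfloor>" for n
      using srs_orbit_recurrence(3)[of "(r0, r1)" a n] by simp
    \<comment> \<open>Stated for every index of maximal modulus, as it is needed at both
      \<open>k\<close> and \<open>Suc k\<close>.\<close>
    have not_neg: "\<not> ?s (Suc n) < 0" if "n \<ge> n0" "\<bar>?s (Suc n)\<bar> = \<bar>?s (Suc k)\<bar>" for n
      using floor_combination_neg[OF r, of "?s n" "?s (Suc n)"] step[of n]
        max[of n] max[of "Suc (Suc n)"] that by linarith
    have not_pos: "\<not> ?s (Suc k) > 0"
    proof
      assume "?s (Suc k) > 0"
      then show False
        \<comment> \<open>The next term is at most \<open>- ?s (Suc k)\<close>, so by maximality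
          equal to it: a negative term of maximal modulus.\<close>
        using floor_combination_pos[OF r, of "?s k" "?s (Suc k)"] step[of k]
          max[of k] max[of "Suc (Suc k)"] not_neg[of "Suc k"] k by linarith
    qed
    have "?s (Suc k) = 0" using not_neg[OF k] not_pos by simp
    then show ?thesis
      using max unfolding ends_in_trivial_cycle_def by auto
  qed
  then show ?thesis unfolding D2_star_def by auto
qed

end
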